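(* Let $m,n$ be positive integers, $X$ an open subset of $\mathbf{Q}_p^m$ and $Y$ an open subset of $\mathbf{Q}_p^n$. Let $u$ be a distribution on $X\times Y$ and let $\mathscr{K}\colon\mathscr{S}(Y)\to\mathscr{S}'(X)$ be its kernel. Let $\psi\in\mathscr{S}(Y)$. Then \[ \mathrm{WF}_\Lambda(\mathscr{K}\psi)\subset\{(x,\xi)\in X\times(\mathbf{Q}_p^m\setminus\{0\}) \mid \exists y\in\operatorname{supp}\psi,\ ((x,y),(\xi,0))\in\mathrm{WF}_\Lambda(u)\}. \]
   Context: $p$ is a prime, $\mathbf{Z}_p$ the ring of integers of $\mathbf{Q}_p$, $\operatorname{ord}$ the $p$-adic valuation. For an open set $Z\subseteq\mathbf{Q}_p^k$, $\mathscr{S}(Z)$ is the space of Schwartz--Bruhat functions (locally constant, compactly supported functions $Z\to\mathbf{C}$) and a distribution on $Z$ is any $\mathbf{C}$-linear form on $\mathscr{S}(Z)$; $\mathscr{S}'(Z)$ is the space of distributions. The kernel of a distribution $u$ on $X\times Y$ is the unique $\mathbf{C}$-linear map $\mathscr{K}\colon\mathscr{S}(Y)\to\mathscr{S}'(X)$ with $\langle u,\phi\otimes\psi\rangle=\langle\mathscr{K}\psi,\phi\rangle$ for all $\phi\in\mathscr{S}(X),\psi\in\mathscr{S}(Y)$, where $(\phi\otimes\psi)(x,y)=\phi(x)\psi(y)$. Fix an additive character $\Psi\colon\mathbf{Q}_p\to\mathbf{C}^\times$ nontrivial on $\mathbf{Z}_p$ and trivial on $p\mathbf{Z}_p$, and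 an open subgroup $\Lambda$ of finite index of $\mathbf{Q}_p^\times$; $\langle\cdot,\cdot\rangle$ is the standard bilinear form on $\mathbf{Q}_p^k$. A distribution $u$ on an open $Z\subseteq\mathbf{Q}_p^k$ is $\Lambda$-microlocally smooth at $(x_0,\xi_0)\in Z\times(\mathbf{Q}_p^k\setminus\{0\})$ if there are open neighborhoods $U$ of $x_0$ in $Z$ and $\check U$ of $\xi_0$ in $\mathbf{Q}_p^k\setminus\{0\}$ such that for every $\varphi\in\mathscr{S}(Z)$ with $\operatorname{supp}\varphi\subset U$ there is an integer $N$ with $\langle u,\varphi\cdot\Psi(\langle\cdot,\lambda\xi\rangle)\rangle=0$ for all $\lambda\in\Lambda$ with $\operatorname{ord}\lambda<N$ and all $\xi\in\check U$. The $\Lambda$-wave front set $\mathrm{WF}_\Lambda(u)$ is the set of points of $Z\times(\mathbf{Q}_p^k\setminus\{0\})$ at which $u$ is not $\Lambda$-microlocally smooth. *)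

theory Defs
  imports "HOL-Analysis.Analysis" "Berlekamp_Zassenhaus.Finite_Field"
begin

section \<open>The field of p-adic numbers\<close>

subsection \<open>The p-adic absolute value on the rationals\<close>

definition rat_padic_val :: "nat \<Rightarrow> rat \<Rightarrow> int" where
  "rat_padic_val p q =
     int (multiplicity (int p) (fst (quotient_of q))) -
     int (multiplicity (int p) (snd (quotient_of q)))"

definition rat_padic_abs :: "nat \<Rightarrow> rat \<Rightarrow> real" where
  "rat_padic_abs p q = (if q = 0 then 0 else real p powi (- rat_padic_val p q))"

lemma rat_padic_val_Fract:
  assumes p: "prime p" and ab: "a \<noteq> 0" "b \<noteq> 0"
  shows "rat_padic_val p (Rat.Fract a b) =
           int (multiplicity (int p) a) - int (multiplicity (int p) b)"
proof -
  obtain c d where cd: "quotient_of (Rat.Fract a b) = (c, d)"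
    by force
  have d: "d \<noteq> 0"
    using quotient_of_denom_pos[OF cd] by simp
  have "Rat.Fract c d = Rat.Fract a b"
    using quotient_of_eq[OF cd] .
  hence eq: "c * b = a * d"
    using d ab by (simp add: eq_rat)
  have c: "c \<noteq> 0"
    using eq d ab by auto
  have "prime_elem (int p)"
    using p by simp
  hence "multiplicity (int p) c + multiplicity (int p) b
       = multiplicity (int p) a + multiplicity (int p) d"
    using eq c d ab by (metis prime_elem_multiplicity_mult_distrib)
  thus ?thesis
    unfolding rat_padic_val_def cd by simp
qed

lemma rat_padic_abs_Fract:
  assumes "prime p" "a \<noteq> 0" "b \<noteq> 0"
  shows "rat_padic_abs p (Rat.Fract a b) =
           real p powi (int (multiplicity (int p) b) - int (multiplicity (int p) a))"
  using assms by (simp add: rat_padic_abs_def rat_padic_val_Fract Zero_rat_def eq_rat)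

lemma rat_padic_abs_0 [simp]: "rat_padic_abs p 0 = 0"
  by (simp add: rat_padic_abs_def)

lemma rat_padic_abs_nonneg [simp]: "rat_padic_abs p x \<ge> 0"
  by (simp add: rat_padic_abs_def)

lemma rat_padic_abs_eq_0_iff:
  "prime p \<Longrightarrow> rat_padic_abs p x = 0 \<longleftrightarrow> x = 0"
  by (auto simp: rat_padic_abs_def dest: prime_gt_0_nat)

lemma rat_padic_abs_1 [simp]: "rat_padic_abs p 1 = 1"
  by (simp add: rat_padic_abs_def rat_padic_val_def)

lemma rat_padic_abs_mult:
  assumes p: "prime p"
  shows "rat_padic_abs p (x * y) = rat_padic_abs p x * rat_padic_abs p y"
proof (cases "x = 0 \<or> y = 0")
  case False
  obtain a b where x: "x = Rat.Fract a b" "b \<noteq> 0"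
    by (cases x) auto
  obtain c d where y: "y = Rat.Fract c d" "d \<noteq> 0"
    by (cases y) auto
  have ac: "a \<noteq> 0" "c \<noteq> 0"
    using False x y by (auto simp: rat_number_collapse)
  have pp: "prime_elem (int p)"
    using p by simp
  have p0: "real p \<noteq> 0"
    using p by (auto dest: prime_gt_0_nat)
  have "rat_padic_abs p (x * y) = rat_padic_abs p (Rat.Fract (a * c) (b * d))"
    using x y by simp
  also have "\<dots> = real p powi ((int (multiplicity (int p) b) - int (multiplicity (int p) a)) +
                      (int (multiplicity (int p) d) - int (multiplicity (int p) c)))"
    using p x y ac
    by (simp add: rat_padic_abs_Fract prime_elem_multiplicity_mult_distrib[OF pp] algebra_simps)
  also have "\<dots> = rat_padic_abs p x * rat_padic_abs p y"
    using p x y ac p0 by (simp add: rat_padic_abs_Fract power_int_add)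
  finally show ?thesis .
qed auto

lemma rat_padic_abs_minus:
  assumes p: "prime p"
  shows "rat_padic_abs p (- x) = rat_padic_abs p x"
proof -
  have "rat_padic_abs p (-1) = 1"
    by (simp add: rat_padic_abs_def rat_padic_val_def multiplicity_unit_right)
  thus ?thesis
    using rat_padic_abs_mult[OF p, of "-1" x] by simp
qed

lemma rat_padic_abs_diff_commute:
  "prime p \<Longrightarrow> rat_padic_abs p (x - y) = rat_padic_abs p (y - x)"
  by (metis minus_diff_eq rat_padic_abs_minus)

lemma rat_padic_abs_add_le_max:
  assumes p: "prime p"
  shows "rat_padic_abs p (x + y) \<le> max (rat_padic_abs p x) (rat_padic_abs p y)"
proof (cases "x = 0 \<or> y = 0 \<or> x + y = 0")
  case False
  obtain a b where x: "x = Rat.Fract a b" "b \<noteq> 0"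
    by (cases x) auto
  obtain c d where y: "y = Rat.Fract c d" "d \<noteq> 0"
    by (cases y) auto
  have ac: "a \<noteq> 0" "c \<noteq> 0"
    using False x y by (auto simp: rat_number_collapse)
  define e where "e = b * d"
  define s where "s = a * d"
  define t where "t = c * b"
  have nz: "e \<noteq> 0" "s \<noteq> 0" "t \<noteq> 0"
    using x y ac by (auto simp: e_def s_def t_def)
  have xe: "x = Rat.Fract s e" and ye: "y = Rat.Fract t e"
    using x y by (auto simp: e_def s_def t_def eq_rat)
  have xy: "x + y = Rat.Fract (s + t) e"
    using x y by (simp add: e_def s_def t_def)
  have st: "s + t \<noteq> 0"
    using False xy by (auto simp: rat_number_collapse)
  define M where "M = multiplicity (int p)"
  have "int p ^ min (M s) (M t) dvd s + t"
    unfolding M_def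
    by (intro dvd_add multiplicity_dvd' ) auto
  hence "min (M s) (M t) \<le> M (s + t)"
    unfolding M_def using st p by (intro multiplicity_geI) (auto dest: prime_gt_1_nat)
  hence "M s \<le> M (s + t) \<or> M t \<le> M (s + t)"
    by auto
  moreover have "real p \<ge> 1"
    using prime_gt_0_nat[OF p] by simp
  ultimately show ?thesis
    unfolding xy unfolding xe ye rat_padic_abs_Fract[OF p st nz(1)]
      rat_padic_abs_Fract[OF p nz(2,1)] rat_padic_abs_Fract[OF p nz(3,1)] M_def
    by (auto simp: le_max_iff_disj intro!: power_int_increasing)
qed (auto simp: le_max_iff_disj)

lemma rat_padic_abs_triangle:
  "prime p \<Longrightarrow> rat_padic_abs p (x + y) \<le> rat_padic_abs p x + rat_padic_abs p y"
  using rat_padic_abs_add_le_max[of p x y] rat_padic_abs_nonneg[of p x]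
    rat_padic_abs_nonneg[of p y] by linarith

lemma rat_padic_abs_diff_le:
  assumes p: "prime p"
  shows "\<bar>rat_padic_abs p x - rat_padic_abs p y\<bar> \<le> rat_padic_abs p (x - y)"
  using rat_padic_abs_triangle[OF p, of "x - y" y] rat_padic_abs_triangle[OF p, of "y - x" x]
    rat_padic_abs_diff_commute[OF p, of x y] by simp

lemma rat_padic_abs_inverse:
  assumes p: "prime p"
  shows "rat_padic_abs p (inverse x) = inverse (rat_padic_abs p x)"
proof (cases "x = 0")
  case False
  thus ?thesis
    using rat_padic_abs_mult[OF p, of x "inverse x"]
    by (metis inverse_unique rat_padic_abs_1 right_inverse)
qed auto

lemma rat_padic_abs_eqI:
  assumes p: "prime p" and less: "rat_padic_abs p (x - y) < rat_padic_abs p y"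
  shows "rat_padic_abs p x = rat_padic_abs p y"
  using rat_padic_abs_add_le_max[OF p, of "x - y" y] rat_padic_abs_add_le_max[OF p, of "y - x" x]
    rat_padic_abs_diff_commute[OF p, of x y] less by (auto simp: max_def split: if_splits)


subsection \<open>Cauchy sequences and null sequences\<close>

definition padic_Cauchy :: "nat \<Rightarrow> (nat \<Rightarrow> rat) \<Rightarrow> bool" where
  "padic_Cauchy p X \<longleftrightarrow>
     (\<forall>e>0. \<exists>k. \<forall>m\<ge>k. \<forall>n\<ge>k. rat_padic_abs p (X m - X n) < e)"

definition padic_null :: "nat \<Rightarrow> (nat \<Rightarrow> rat) \<Rightarrow> bool" where
  "padic_null p X \<longleftrightarrow> (\<lambda>n. rat_padic_abs p (X n)) \<longlonglongrightarrow> 0"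

definition padic_rel :: "nat \<Rightarrow> (nat \<Rightarrow> rat) \<Rightarrow> (nat \<Rightarrow> rat) \<Rightarrow> bool" where
  "padic_rel p X Y \<longleftrightarrow>
     padic_Cauchy p X \<and> padic_Cauchy p Y \<and> padic_null p (\<lambda>n. X n - Y n)"

lemma padic_null_zero [simp]: "padic_null p (\<lambda>n. 0)"
  by (simp add: padic_null_def)

lemma padic_Cauchy_const [simp]: "padic_Cauchy p (\<lambda>n. c)"
  by (simp add: padic_Cauchy_def)

lemma padic_null_le:
  assumes "padic_null p X" "eventually (\<lambda>n. rat_padic_abs p (Y n) \<le> C * rat_padic_abs p (X n)) sequentially"
  shows "padic_null p Y"
proof -
  have "(\<lambda>n. C * rat_padic_abs p (X n)) \<longlonglongrightarrow> C * 0"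
    using assms(1) unfolding padic_null_def by (intro tendsto_intros)
  hence *: "(\<lambda>n. C * rat_padic_abs p (X n)) \<longlonglongrightarrow> 0"
    by simp
  show ?thesis
    unfolding padic_null_def
    by (rule tendsto_sandwich[OF _ assms(2) tendsto_const *]) auto
qed

lemma padic_null_minus:
  assumes "prime p" "padic_null p X"
  shows "padic_null p (\<lambda>n. - X n)"
  using assms by (simp add: padic_null_def rat_padic_abs_minus)

lemma padic_null_add:
  assumes p: "prime p" and XY: "padic_null p X" "padic_null p Y"
  shows "padic_null p (\<lambda>n. X n + Y n)"
proof -
  have "(\<lambda>n. rat_padic_abs p (X n) + rat_padic_abs p (Y n)) \<longlonglongrightarrow> 0 + 0"
    using XY unfolding padic_null_def by (intro tendsto_intros)
  hence *: "(\<lambda>n. rat_padic_abs p (X n) + rat_padic_abs p (Y n)) \<longlonglongrightarrow> 0"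
    by simp
  show ?thesis
    unfolding padic_null_def
    by (rule tendsto_sandwich[OF _ _ tendsto_const *]) (auto simp: rat_padic_abs_triangle[OF p])
qed

lemma padic_Cauchy_minus:
  assumes p: "prime p" and X: "padic_Cauchy p X"
  shows "padic_Cauchy p (\<lambda>n. - X n)"
proof -
  have "rat_padic_abs p (- X m - - X n) = rat_padic_abs p (X m - X n)" for m n
    using rat_padic_abs_diff_commute[OF p, of "X m" "X n"] by simp
  thus ?thesis
    using X unfolding padic_Cauchy_def by simp
qed

lemma padic_Cauchy_add:
  assumes p: "prime p" and X: "padic_Cauchy p X" and Y: "padic_Cauchy p Y"
  shows "padic_Cauchy p (\<lambda>n. X n + Y n)"
  unfolding padic_Cauchy_def
proof (intro allI impI)
  fix e :: real assume e: "e > 0"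
  obtain k where k: "\<And>m n. m \<ge> k \<Longrightarrow> n \<ge> k \<Longrightarrow> rat_padic_abs p (X m - X n) < e"
    using X e unfolding padic_Cauchy_def by blast
  obtain l where l: "\<And>m n. m \<ge> l \<Longrightarrow> n \<ge> l \<Longrightarrow> rat_padic_abs p (Y m - Y n) < e"
    using Y e unfolding padic_Cauchy_def by blast
  have "rat_padic_abs p (X m + Y m - (X n + Y n)) < e" if "m \<ge> max k l" "n \<ge> max k l" for m n
  proof -
    have "X m + Y m - (X n + Y n) = (X m - X n) + (Y m - Y n)"
      by simp
    hence "rat_padic_abs p (X m + Y m - (X n + Y n)) \<le>
        max (rat_padic_abs p (X m - X n)) (rat_padic_abs p (Y m - Y n))"
      using rat_padic_abs_add_le_max[OF p] by metis
    thus ?thesis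
      using k[of m n] l[of m n] that by auto
  qed
  thus "\<exists>k. \<forall>m\<ge>k. \<forall>n\<ge>k. rat_padic_abs p (X m + Y m - (X n + Y n)) < e"
    by blast
qed

lemma padic_Cauchy_imp_convergent:
  assumes p: "prime p" and X: "padic_Cauchy p X"
  shows "convergent (\<lambda>n. rat_padic_abs p (X n))"
proof -
  have "Cauchy (\<lambda>n. rat_padic_abs p (X n))"
    unfolding Cauchy_def dist_real_def
    using X rat_padic_abs_diff_le[OF p] unfolding padic_Cauchy_def
    by (meson le_less_trans)
  thus ?thesis
    by (rule Cauchy_convergent)
qed

lemma padic_Cauchy_bounded:
  assumes p: "prime p" and X: "padic_Cauchy p X"
  obtains C where "C > 0" "\<And>n. rat_padic_abs p (X n) \<le> C"
proof -
  have "Bseq (\<lambda>n. rat_padic_abs p (X n))"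
    using padic_Cauchy_imp_convergent[OF p X] by (rule convergent_imp_Bseq)
  thus ?thesis
    using that by (auto simp: Bseq_def)
qed

lemma padic_Cauchy_not_null:
  assumes p: "prime p" and X: "padic_Cauchy p X" and "\<not> padic_null p X"
  obtains c k where "c > 0" "\<And>n. n \<ge> k \<Longrightarrow> rat_padic_abs p (X n) > c"
proof -
  obtain L where L: "(\<lambda>n. rat_padic_abs p (X n)) \<longlonglongrightarrow> L"
    using padic_Cauchy_imp_convergent[OF p X] by (auto simp: convergent_def)
  have "L \<ge> 0"
    using L by (rule LIMSEQ_le_const) auto
  moreover have "L \<noteq> 0"
    using assms(3) L by (auto simp: padic_null_def)
  ultimately have "L > 0"
    by simp
  hence "eventually (\<lambda>n. rat_padic_abs p (X n) > L / 2) sequentially"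
    using L by (intro order_tendstoD(1)[OF L]) auto
  thus ?thesis
    using that[of "L / 2"] \<open>L > 0\<close> by (auto simp: eventually_sequentially)
qed

lemma padic_null_mult_bounded:
  assumes p: "prime p" and X: "padic_Cauchy p X" and Y: "padic_null p Y"
  shows "padic_null p (\<lambda>n. X n * Y n)"
proof -
  obtain C where C: "C > 0" "\<And>n. rat_padic_abs p (X n) \<le> C"
    using padic_Cauchy_bounded[OF p X] by blast
  show ?thesis
    by (rule padic_null_le[OF Y, of _ C])
      (auto simp: rat_padic_abs_mult[OF p] intro!: always_eventually mult_right_mono C)
qed

lemma padic_Cauchy_mult:
  assumes p: "prime p" and X: "padic_Cauchy p X" and Y: "padic_Cauchy p Y"
  shows "padic_Cauchy p (\<lambda>n. X n * Y n)"
  unfolding padic_Cauchy_def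
proof (intro allI impI)
  fix e :: real assume e: "e > 0"
  obtain C where C: "C > 0" "\<And>n. rat_padic_abs p (X n) \<le> C"
    using padic_Cauchy_bounded[OF p X] by blast
  obtain D where D: "D > 0" "\<And>n. rat_padic_abs p (Y n) \<le> D"
    using padic_Cauchy_bounded[OF p Y] by blast
  have "e / D > 0" "e / C > 0"
    using e C D by auto
  then obtain k l where
    k: "\<And>m n. m \<ge> k \<Longrightarrow> n \<ge> k \<Longrightarrow> rat_padic_abs p (X m - X n) < e / D" and
    l: "\<And>m n. m \<ge> l \<Longrightarrow> n \<ge> l \<Longrightarrow> rat_padic_abs p (Y m - Y n) < e / C"
    using X Y unfolding padic_Cauchy_def by meson
  have "rat_padic_abs p (X m * Y m - X n * Y n) < e" if "m \<ge> max k l" "n \<ge> max k l" for m n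
  proof -
    have 1: "rat_padic_abs p (X m * (Y m - Y n)) < e"
    proof -
      have "rat_padic_abs p (X m * (Y m - Y n)) \<le> C * rat_padic_abs p (Y m - Y n)"
        by (auto simp: rat_padic_abs_mult[OF p] intro!: mult_right_mono C)
      also have "\<dots> < C * (e / C)"
        using l[of m n] that C by (intro mult_strict_left_mono) auto
      finally show ?thesis
        using C by simp
    qed
    have 2: "rat_padic_abs p ((X m - X n) * Y n) < e"
    proof -
      have "rat_padic_abs p ((X m - X n) * Y n) \<le> rat_padic_abs p (X m - X n) * D"
        by (auto simp: rat_padic_abs_mult[OF p] intro!: mult_left_mono D)
      also have "\<dots> < (e / D) * D"
        using k[of m n] that D by (intro mult_strict_right_mono) auto
      finally show ?thesis
        using D by simp
    qed
    have "X m * Y m - X n * Y n = X m * (Y m - Y n) + (X m - X n) * Y n"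
      by (simp add: algebra_simps)
    hence "rat_padic_abs p (X m * Y m - X n * Y n) \<le>
        max (rat_padic_abs p (X m * (Y m - Y n))) (rat_padic_abs p ((X m - X n) * Y n))"
      using rat_padic_abs_add_le_max[OF p] by metis
    thus ?thesis
      using 1 2 by linarith
  qed
  thus "\<exists>k. \<forall>m\<ge>k. \<forall>n\<ge>k. rat_padic_abs p (X m * Y m - X n * Y n) < e"
    by blast
qed

lemma rat_padic_abs_diff_inverse:
  assumes p: "prime p" and c: "c > 0" "rat_padic_abs p x > c" "rat_padic_abs p y > c"
  shows "rat_padic_abs p (inverse x - inverse y) \<le> inverse (c ^ 2) * rat_padic_abs p (x - y)"
proof -
  have nz: "x \<noteq> 0" "y \<noteq> 0"
    using c by auto
  have "inverse x - inverse y = (y - x) * (inverse x * inverse y)"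
    using nz by (simp add: field_simps)
  hence "rat_padic_abs p (inverse x - inverse y)
       = rat_padic_abs p (x - y) * (inverse (rat_padic_abs p x) * inverse (rat_padic_abs p y))"
    by (simp add: rat_padic_abs_mult[OF p] rat_padic_abs_inverse[OF p]
          rat_padic_abs_diff_commute[OF p, of y x])
  also have "\<dots> \<le> rat_padic_abs p (x - y) * (inverse c * inverse c)"
    using c by (intro mult_left_mono mult_mono le_imp_inverse_le) auto
  finally show ?thesis
    by (simp add: power2_eq_square mult.commute)
qed

lemma padic_Cauchy_inverse:
  assumes p: "prime p" and X: "padic_Cauchy p X" and nn: "\<not> padic_null p X"
  shows "padic_Cauchy p (\<lambda>n. inverse (X n))"
  unfolding padic_Cauchy_def
proof (intro allI impI)
  fix e :: real assume e: "e > 0"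
  obtain c k where c: "c > 0" "\<And>n. n \<ge> k \<Longrightarrow> rat_padic_abs p (X n) > c"
    using padic_Cauchy_not_null[OF p X nn] by blast
  have "c ^ 2 * e > 0"
    using e c by simp
  then obtain l where l: "\<And>m n. m \<ge> l \<Longrightarrow> n \<ge> l \<Longrightarrow> rat_padic_abs p (X m - X n) < c ^ 2 * e"
    using X unfolding padic_Cauchy_def by meson
  have "rat_padic_abs p (inverse (X m) - inverse (X n)) < e"
    if "m \<ge> max k l" "n \<ge> max k l" for m n
  proof -
    have "rat_padic_abs p (inverse (X m) - inverse (X n))
        \<le> inverse (c ^ 2) * rat_padic_abs p (X m - X n)"
      using c that by (intro rat_padic_abs_diff_inverse p) auto
    also have "\<dots> < inverse (c ^ 2) * (c ^ 2 * e)"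
      using l[of m n] that c by (intro mult_strict_left_mono) auto
    also have "\<dots> = e"
      using c by simp
    finally show ?thesis .
  qed
  thus "\<exists>k. \<forall>m\<ge>k. \<forall>n\<ge>k. rat_padic_abs p (inverse (X m) - inverse (X n)) < e"
    by blast
qed

lemma padic_null_diff_inverse:
  assumes p: "prime p"
    and X: "padic_Cauchy p X" "\<not> padic_null p X"
    and Y: "padic_Cauchy p Y" "\<not> padic_null p Y"
    and XY: "padic_null p (\<lambda>n. X n - Y n)"
  shows "padic_null p (\<lambda>n. inverse (X n) - inverse (Y n))"
proof -
  obtain c k where c: "c > 0" "\<And>n. n \<ge> k \<Longrightarrow> rat_padic_abs p (X n) > c"
    using padic_Cauchy_not_null[OF p X] by blast
  obtain d l where d: "d > 0" "\<And>n. n \<ge> l \<Longrightarrow> rat_padic_abs p (Y n) > d"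
    using padic_Cauchy_not_null[OF p Y] by blast
  have "\<forall>n\<ge>max k l. rat_padic_abs p (inverse (X n) - inverse (Y n))
          \<le> inverse ((min c d) ^ 2) * rat_padic_abs p (X n - Y n)"
    using c d by (intro allI impI rat_padic_abs_diff_inverse p) (auto simp: min_less_iff_disj)
  hence "eventually (\<lambda>n. rat_padic_abs p (inverse (X n) - inverse (Y n))
          \<le> inverse ((min c d) ^ 2) * rat_padic_abs p (X n - Y n)) sequentially"
    unfolding eventually_sequentially by blast
  thus ?thesis
    by (rule padic_null_le[OF XY])
qed

lemma padic_null_cong:
  assumes p: "prime p" and XY: "padic_null p (\<lambda>n. X n - Y n)"
  shows "padic_null p X \<longleftrightarrow> padic_null p Y"
proof
  assume "padic_null p X"
  from padic_null_add[OF p this padic_null_minus[OF p XY]] show "padic_null p Y"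
    by simp
next
  assume "padic_null p Y"
  from padic_null_add[OF p this XY] show "padic_null p X"
    by simp
qed

lemma padic_rel_refl: "padic_Cauchy p X \<Longrightarrow> padic_rel p X X"
  by (simp add: padic_rel_def)

lemma part_equivp_padic_rel:
  assumes p: "prime p"
  shows "part_equivp (padic_rel p)"
proof (rule part_equivpI)
  show "\<exists>X. padic_rel p X X"
    by (rule exI[of _ "\<lambda>_. 0"]) (simp add: padic_rel_def)
  show "symp (padic_rel p)"
    by (rule sympI) (auto simp: padic_rel_def dest: padic_null_minus[OF p])
  show "transp (padic_rel p)"
    by (rule transpI) (force simp: padic_rel_def dest: padic_null_add[OF p])
qed


subsection \<open>Completion of the rationals\<close>

text \<open>
  The prime is the cardinality of the type parameter, so that a statement about
  \<open>'p padic\<close> for arbitrary \<open>'p\<close> of class \<open>prime_card\<close> is one about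
  all primes.
\<close>

typedef (overloaded) 'p padic =
  "{C. \<exists>X. padic_rel CARD('p::prime_card) X X \<and> C = Collect (padic_rel CARD('p) X)}"
proof -
  have "padic_rel CARD('p) (\<lambda>_. 0) (\<lambda>_. 0)"
    by (simp add: padic_rel_refl)
  thus ?thesis
    by blast
qed

definition padic_of_seq :: "(nat \<Rightarrow> rat) \<Rightarrow> 'p::prime_card padic" where
  "padic_of_seq X = Abs_padic (Collect (padic_rel CARD('p) X))"

definition seq_of_padic :: "'p::prime_card padic \<Rightarrow> nat \<Rightarrow> rat" where
  "seq_of_padic x = (SOME X. X \<in> Rep_padic x)"

definition cr_padic :: "(nat \<Rightarrow> rat) \<Rightarrow> 'p::prime_card padic \<Rightarrow> bool" where
  "cr_padic X x \<longleftrightarrow> padic_rel CARD('p) X X \<and> padic_of_seq X = x"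

lemma Quotient_padic:
  "Quotient (padic_rel CARD('p::prime_card)) (padic_of_seq :: _ \<Rightarrow> 'p padic) seq_of_padic cr_padic"
proof -
  interpret quot_type "padic_rel CARD('p)" "Abs_padic :: _ \<Rightarrow> 'p padic" Rep_padic
    using part_equivp_padic_rel[OF prime_card[where 'a = 'p]] Rep_padic[where 'p = 'p]
    by unfold_locales (auto simp: Rep_padic_inverse Abs_padic_inverse Rep_padic_inject)
  have "abs = padic_of_seq" "rep = seq_of_padic"
    by (simp_all add: fun_eq_iff abs_def rep_def padic_of_seq_def seq_of_padic_def)
  hence "Quotient3 (padic_rel CARD('p)) (padic_of_seq :: _ \<Rightarrow> 'p padic) seq_of_padic"
    using Quotient by simp
  moreover have "cr_padic \<equiv> \<lambda>X (x :: 'p padic). padic_rel CARD('p) X X \<and> padic_of_seq X = x"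
    by (rule eq_reflection) (simp add: fun_eq_iff cr_padic_def)
  ultimately show ?thesis
    by (rule Quotient3_to_Quotient)
qed

setup_lifting Quotient_padic

lemma Domainp_pcr_padic [transfer_domain_rule]:
  "Domainp (pcr_padic :: _ \<Rightarrow> 'p::prime_card padic \<Rightarrow> _) = padic_Cauchy CARD('p)"
  by (simp add: padic.domain_eq padic_rel_def)

instantiation padic :: (prime_card) field
begin

lift_definition zero_padic :: "'a padic" is "\<lambda>n. 0"
  by (simp add: padic_rel_refl)

lift_definition one_padic :: "'a padic" is "\<lambda>n. 1"
  by (simp add: padic_rel_refl)

lift_definition plus_padic :: "'a padic \<Rightarrow> 'a padic \<Rightarrow> 'a padic" is "\<lambda>X Y n. X n + Y n"
  by (auto simp: padic_rel_def add_diff_add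
        intro: padic_Cauchy_add padic_null_add prime_card)

lift_definition uminus_padic :: "'a padic \<Rightarrow> 'a padic" is "\<lambda>X n. - X n"
  unfolding padic_rel_def minus_diff_minus
  by (intro conjI padic_Cauchy_minus padic_null_minus prime_card) auto

lift_definition times_padic :: "'a padic \<Rightarrow> 'a padic \<Rightarrow> 'a padic" is "\<lambda>X Y n. X n * Y n"
proof -
  fix X X' Y Y'
  assume X: "padic_rel CARD('a) X X'" and Y: "padic_rel CARD('a) Y Y'"
  have "padic_null CARD('a) (\<lambda>n. X n * (Y n - Y' n) + Y' n * (X n - X' n))"
    using X Y unfolding padic_rel_def
    by (intro padic_null_add padic_null_mult_bounded prime_card) auto
  hence "padic_null CARD('a) (\<lambda>n. X n * Y n - X' n * Y' n)"
    by (simp add: algebra_simps)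
  thus "padic_rel CARD('a) (\<lambda>n. X n * Y n) (\<lambda>n. X' n * Y' n)"
    using X Y unfolding padic_rel_def by (auto intro: padic_Cauchy_mult prime_card)
qed

lift_definition inverse_padic :: "'a padic \<Rightarrow> 'a padic"
  is "\<lambda>X. if padic_null CARD('a) X then (\<lambda>n. 0) else (\<lambda>n. inverse (X n))"
proof -
  fix X Y
  assume XY: "padic_rel CARD('a) X Y"
  have "padic_null CARD('a) X \<longleftrightarrow> padic_null CARD('a) Y"
    using XY unfolding padic_rel_def by (intro padic_null_cong prime_card) auto
  thus "padic_rel CARD('a)
          (if padic_null CARD('a) X then (\<lambda>n. 0) else (\<lambda>n. inverse (X n)))
          (if padic_null CARD('a) Y then (\<lambda>n. 0) else (\<lambda>n. inverse (Y n)))"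
    using XY unfolding padic_rel_def
    by (auto intro: padic_Cauchy_inverse padic_null_diff_inverse prime_card)
qed

definition "x - y = x + - y" for x y :: "'a padic"

definition "x div y = x * inverse y" for x y :: "'a padic"

instance
proof
  fix a b c :: "'a padic"
  show "a + b = b + a"
    by transfer (auto simp: ac_simps padic_rel_def intro: padic_Cauchy_add prime_card)
  show "(a + b) + c = a + (b + c)"
    by transfer (auto simp: ac_simps padic_rel_def intro!: padic_Cauchy_add prime_card)
  show "0 + a = a"
    by transfer (simp add: padic_rel_def)
  show "- a + a = 0"
    by transfer (simp add: padic_rel_def)
  show "a - b = a + - b"
    by (rule minus_padic_def)
  show "(a * b) * c = a * (b * c)"
    by transfer (auto simp: ac_simps padic_rel_def intro!: padic_Cauchy_mult prime_card)
  show "a * b = b * a"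
    by transfer (auto simp: ac_simps padic_rel_def intro!: padic_Cauchy_mult prime_card)
  show "1 * a = a"
    by transfer (simp add: padic_rel_def)
  show "(a + b) * c = a * c + b * c"
    by transfer (auto simp: distrib_right padic_rel_def
                   intro!: padic_Cauchy_mult padic_Cauchy_add prime_card)
  show "(0::'a padic) \<noteq> 1"
  proof (transfer, rule notI)
    assume "padic_rel CARD('a) (\<lambda>n. 0) (\<lambda>n. 1)"
    thus False
      using rat_padic_abs_minus[OF prime_card[where 'a = 'a], of 1]
      by (simp add: padic_rel_def padic_null_def LIMSEQ_const_iff)
  qed
  have *: "padic_null CARD('a) (\<lambda>n. inverse (X n) * X n - 1)"
    if X: "padic_Cauchy CARD('a) X" "\<not> padic_null CARD('a) X" for X
  proof -
    obtain c k where c: "c > 0" "\<And>n. n \<ge> k \<Longrightarrow> rat_padic_abs CARD('a) (X n) > c"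
      using padic_Cauchy_not_null[OF prime_card X] by blast
    have "X n \<noteq> 0" if "n \<ge> k" for n
      using c(1) c(2)[OF that] by auto
    hence "eventually (\<lambda>n. rat_padic_abs CARD('a) (inverse (X n) * X n - 1) = 0) sequentially"
      unfolding eventually_sequentially by (intro exI[of _ k]) auto
    thus ?thesis
      unfolding padic_null_def by (rule tendsto_eventually)
  qed
  show "a \<noteq> 0 \<Longrightarrow> inverse a * a = 1"
    by transfer (auto simp: padic_rel_def * intro!: padic_Cauchy_mult padic_Cauchy_inverse prime_card)
  show "a div b = a * inverse b"
    by (rule divide_padic_def)
  show "inverse (0::'a padic) = 0"
    by transfer (simp add: padic_rel_def)
qed

end


subsection \<open>Absolute value, topology and valuation\<close>

lift_definition padic_norm :: "'a::prime_card padic \<Rightarrow> real"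
  is "\<lambda>X. lim (\<lambda>n. rat_padic_abs CARD('a) (X n))"
proof -
  fix X Y
  assume XY: "padic_rel CARD('a) X Y"
  let ?a = "rat_padic_abs CARD('a)"
  obtain L where L: "(\<lambda>n. ?a (X n)) \<longlonglongrightarrow> L"
    using padic_Cauchy_imp_convergent[OF prime_card, of X] XY
    by (auto simp: padic_rel_def convergent_def)
  have 0: "(\<lambda>n. ?a (X n - Y n)) \<longlonglongrightarrow> 0"
    using XY by (simp add: padic_rel_def padic_null_def)
  have "(\<lambda>n. ?a (X n) - ?a (Y n)) \<longlonglongrightarrow> 0"
    by (rule Lim_null_comparison[OF _ 0])
      (auto intro!: always_eventually rat_padic_abs_diff_le prime_card)
  from tendsto_diff[OF L this] have "(\<lambda>n. ?a (Y n)) \<longlonglongrightarrow> L"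
    by simp
  thus "lim (\<lambda>n. ?a (X n)) = lim (\<lambda>n. ?a (Y n))"
    using L by (simp add: limI)
qed

lemma padic_abs_LIMSEQ:
  assumes "padic_Cauchy CARD('p::prime_card) X"
  shows "(\<lambda>n. rat_padic_abs CARD('p) (X n)) \<longlonglongrightarrow> lim (\<lambda>n. rat_padic_abs CARD('p) (X n))"
  using padic_Cauchy_imp_convergent[OF prime_card assms] by (simp add: convergent_LIMSEQ_iff)

lemma padic_norm_nonneg: "padic_norm (x :: 'p::prime_card padic) \<ge> 0"
  by transfer (auto intro: LIMSEQ_le_const[OF padic_abs_LIMSEQ])

lemma padic_norm_0: "padic_norm (0 :: 'p::prime_card padic) = 0"
  by transfer (simp add: limI)

lemma padic_norm_1: "padic_norm (1 :: 'p::prime_card padic) = 1"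
  by transfer (simp add: limI)

lemma padic_norm_eq_0_iff: "padic_norm (x :: 'p::prime_card padic) = 0 \<longleftrightarrow> x = 0"
proof (transfer, safe)
  fix X assume X: "padic_Cauchy CARD('p) X" and 0: "lim (\<lambda>n. rat_padic_abs CARD('p) (X n)) = 0"
  show "padic_rel CARD('p) X (\<lambda>n. 0)"
    using padic_abs_LIMSEQ[OF X] X 0 by (simp add: padic_rel_def padic_null_def)
next
  fix X assume "padic_rel CARD('p) X (\<lambda>n. 0)"
  thus "lim (\<lambda>n. rat_padic_abs CARD('p) (X n)) = 0"
    by (simp add: padic_rel_def padic_null_def limI)
qed

lemma padic_norm_minus: "padic_norm (- x) = padic_norm (x :: 'p::prime_card padic)"
  by transfer (simp add: rat_padic_abs_minus[OF prime_card])

lemma padic_norm_mult: "padic_norm (x * y) = padic_norm x * padic_norm (y :: 'p::prime_card padic)"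
proof transfer
  fix X Y assume X: "padic_Cauchy CARD('p) X" and Y: "padic_Cauchy CARD('p) Y"
  show "lim (\<lambda>n. rat_padic_abs CARD('p) (X n * Y n)) =
          lim (\<lambda>n. rat_padic_abs CARD('p) (X n)) * lim (\<lambda>n. rat_padic_abs CARD('p) (Y n))"
    using tendsto_mult[OF padic_abs_LIMSEQ[OF X] padic_abs_LIMSEQ[OF Y]]
    by (simp add: limI rat_padic_abs_mult[OF prime_card])
qed

lemma padic_norm_add_le_max: "padic_norm (x + y) \<le> max (padic_norm x) (padic_norm (y :: 'p::prime_card padic))"
proof transfer
  fix X Y assume X: "padic_Cauchy CARD('p) X" and Y: "padic_Cauchy CARD('p) Y"
  show "lim (\<lambda>n. rat_padic_abs CARD('p) (X n + Y n)) \<le>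
          max (lim (\<lambda>n. rat_padic_abs CARD('p) (X n))) (lim (\<lambda>n. rat_padic_abs CARD('p) (Y n)))"
    by (rule LIMSEQ_le[OF padic_abs_LIMSEQ[OF padic_Cauchy_add[OF prime_card X Y]]
              tendsto_max[OF padic_abs_LIMSEQ[OF X] padic_abs_LIMSEQ[OF Y]]])
      (auto intro!: rat_padic_abs_add_le_max prime_card)
qed

instantiation padic :: (prime_card) metric_space
begin

definition dist_padic :: "'a padic \<Rightarrow> 'a padic \<Rightarrow> real" where
  "dist_padic x y = padic_norm (x - y)"

definition uniformity_padic :: "('a padic \<times> 'a padic) filter" where
  "uniformity_padic = (INF e\<in>{0<..}. principal {(x, y). dist x y < e})"

definition open_padic :: "'a padic set \<Rightarrow> bool" where
  "open_padic U \<longleftrightarrow> (\<forall>x\<in>U. eventually (\<lambda>(x', y). x' = x \<longrightarrow> y \<in> U) uniformity)"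

instance
proof
  fix x y z :: "'a padic"
  show "dist x y = 0 \<longleftrightarrow> x = y"
    by (simp add: dist_padic_def padic_norm_eq_0_iff)
  have "padic_norm (x - y) \<le> max (padic_norm (x - z)) (padic_norm (z - y))"
    using padic_norm_add_le_max[of "x - z" "z - y"] by simp
  also have "padic_norm (z - y) = padic_norm (y - z)"
    using padic_norm_minus[of "y - z"] by simp
  finally show "dist x y \<le> dist x z + dist y z"
    using padic_norm_nonneg[of "x - z"] padic_norm_nonneg[of "y - z"]
    unfolding dist_padic_def by linarith
qed (simp_all add: uniformity_padic_def open_padic_def)

end

text \<open>Only meaningful for nonzero arguments.\<close>

definition padic_ord :: "'p::prime_card padic \<Rightarrow> int" where
  "padic_ord x = (THE k. padic_norm x = real CARD('p) powi (- k))"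

lemma norm_eq_powi_padic_ord:
  fixes x :: "'p::prime_card padic"
  assumes "x \<noteq> 0"
  shows "padic_norm x = real CARD('p) powi (- padic_ord x)"
proof -
  have p1: "real CARD('p) > 1"
    using prime_gt_1_nat[OF prime_card[where 'a = 'p]] by simp
  have "\<exists>k. padic_norm x = real CARD('p) powi (- k)"
    using assms
  proof transfer
    fix X assume X: "padic_Cauchy CARD('p) X" and "\<not> padic_rel CARD('p) X (\<lambda>n. 0)"
    hence nn: "\<not> padic_null CARD('p) X"
      by (simp add: padic_rel_def)
    let ?a = "rat_padic_abs CARD('p)"
    obtain c k where c: "c > 0" "\<And>n. n \<ge> k \<Longrightarrow> ?a (X n) > c"
      using padic_Cauchy_not_null[OF prime_card X nn] by blast
    obtain l where l: "\<And>m n. m \<ge> l \<Longrightarrow> n \<ge> l \<Longrightarrow> ?a (X m - X n) < c"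
      using X c(1) unfolding padic_Cauchy_def by meson
    define N where "N = max k l"
    have "?a (X n) = ?a (X N)" if "n \<ge> N" for n
      using c(2)[of N] l[of n N] that by (intro rat_padic_abs_eqI prime_card) (auto simp: N_def)
    hence "eventually (\<lambda>n. ?a (X n) = ?a (X N)) sequentially"
      unfolding eventually_sequentially by blast
    hence "lim (\<lambda>n. ?a (X n)) = ?a (X N)"
      by (intro limI tendsto_eventually)
    moreover have "X N \<noteq> 0"
      using c(1) c(2)[of N] by (auto simp: N_def)
    ultimately show "\<exists>j. lim (\<lambda>n. ?a (X n)) = real CARD('p) powi (- j)"
      by (auto simp: rat_padic_abs_def)
  qed
  then obtain k where k: "padic_norm x = real CARD('p) powi (- k)" ..
  have "j = k" if "padic_norm x = real CARD('p) powi (- j)" for j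
    using that k p1 power_int_strict_increasing[of "-j" "-k" "real CARD('p)"]
      power_int_strict_increasing[of "-k" "-j" "real CARD('p)"]
    by (cases j k rule: linorder_cases) auto
  hence "padic_ord x = k"
    unfolding padic_ord_def using k by (intro the_equality)
  with k show ?thesis
    by simp
qed

definition padic_integers :: "'p::prime_card padic set" where
  "padic_integers = {x. padic_norm x \<le> 1}"


section \<open>Schwartz--Bruhat functions and distributions\<close>

text \<open>
  A function on \<open>Z\<close> is represented by its extension by zero to the whole space;
  \<open>supp_on Z \<phi>\<close> is the closure of the non-vanishing locus relative to \<open>Z\<close>.
\<close>

definition supp_on :: "'a::topological_space set \<Rightarrow> ('a \<Rightarrow> complex) \<Rightarrow> 'a set" where
  "supp_on Z \<phi> = Z \<inter> closure {x \<in> Z. \<phi> x \<noteq> 0}"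

definition schwartz_bruhat :: "'a::topological_space set \<Rightarrow> ('a \<Rightarrow> complex) set" where
  "schwartz_bruhat Z = {\<phi>.
     (\<forall>x. x \<notin> Z \<longrightarrow> \<phi> x = 0) \<and>
     (\<forall>x\<in>Z. \<exists>U. open U \<and> x \<in> U \<and> (\<forall>y\<in>U \<inter> Z. \<phi> y = \<phi> x)) \<and>
     compact (supp_on Z \<phi>)}"

text \<open>
  Distributions carry no continuity condition; being extensional, two of them are equal
  iff they agree on all Schwartz--Bruhat functions.
\<close>

definition distributions ::
    "'a::topological_space set \<Rightarrow> (('a \<Rightarrow> complex) \<Rightarrow> complex) set" where
  "distributions Z = {u \<in> extensional (schwartz_bruhat Z).
     (\<forall>\<phi>\<in>schwartz_bruhat Z. \<forall>\<psi>\<in>schwartz_bruhat Z. u (\<lambda>x. \<phi> x + \<psi> x) = u \<phi> + u \<psi>) \<and>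
     (\<forall>c. \<forall>\<phi>\<in>schwartz_bruhat Z. u (\<lambda>x. c * \<phi> x) = c * u \<phi>)}"


section \<open>Products and kernels\<close>

text \<open>
  The product of the m- and the n-dimensional space is identified with the
  (m+n)-dimensional one, whose coordinates are indexed by the sum type.
\<close>

definition vec_join :: "'a ^ 'm \<Rightarrow> 'a ^ 'n \<Rightarrow> 'a ^ ('m::finite + 'n::finite)" where
  "vec_join x y = (\<chi> i. case i of Inl j \<Rightarrow> x $ j | Inr j \<Rightarrow> y $ j)"

definition vec_left :: "'a ^ ('m::finite + 'n::finite) \<Rightarrow> 'a ^ 'm" where
  "vec_left z = (\<chi> j. z $ Inl j)"

definition vec_right :: "'a ^ ('m::finite + 'n::finite) \<Rightarrow> 'a ^ 'n" where
  "vec_right z = (\<chi> j. z $ Inr j)"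

definition vec_prod :: "('a ^ 'm) set \<Rightarrow> ('a ^ 'n) set \<Rightarrow> ('a ^ ('m::finite + 'n::finite)) set" where
  "vec_prod X Y = {vec_join x y | x y. x \<in> X \<and> y \<in> Y}"

definition tensor ::
    "('a ^ 'm \<Rightarrow> complex) \<Rightarrow> ('a ^ 'n \<Rightarrow> complex) \<Rightarrow> 'a ^ ('m::finite + 'n::finite) \<Rightarrow> complex" where
  "tensor \<phi> \<psi> z = \<phi> (vec_left z) * \<psi> (vec_right z)"

definition is_kernel ::
    "('a::topological_space ^ 'm::finite) set \<Rightarrow> ('a ^ 'n::finite) set \<Rightarrow>
     (('a ^ ('m + 'n) \<Rightarrow> complex) \<Rightarrow> complex) \<Rightarrow>
     (('a ^ 'n \<Rightarrow> complex) \<Rightarrow> ('a ^ 'm \<Rightarrow> complex) \<Rightarrow> complex) \<Rightarrow> bool" where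
  "is_kernel X Y u K \<longleftrightarrow>
     K \<in> schwartz_bruhat Y \<rightarrow>\<^sub>E distributions X \<and>
     (\<forall>\<psi>\<in>schwartz_bruhat Y. \<forall>\<psi>'\<in>schwartz_bruhat Y. \<forall>\<phi>\<in>schwartz_bruhat X.
        K (\<lambda>y. \<psi> y + \<psi>' y) \<phi> = K \<psi> \<phi> + K \<psi>' \<phi>) \<and>
     (\<forall>c. \<forall>\<psi>\<in>schwartz_bruhat Y. \<forall>\<phi>\<in>schwartz_bruhat X.
        K (\<lambda>y. c * \<psi> y) \<phi> = c * K \<psi> \<phi>) \<and>
     (\<forall>\<phi>\<in>schwartz_bruhat X. \<forall>\<psi>\<in>schwartz_bruhat Y. u (tensor \<phi> \<psi>) = K \<psi> \<phi>)"

lemma vec_left_join [simp]: "vec_left (vec_join x y) = x"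
  and vec_right_join [simp]: "vec_right (vec_join x y) = y"
  by (simp_all add: vec_left_def vec_right_def vec_join_def)

lemma vec_join_left_right [simp]: "vec_join (vec_left z) (vec_right z) = z"
  by (simp add: vec_left_def vec_right_def vec_join_def vec_eq_iff split: sum.split)

lemma mem_vec_prod_iff: "z \<in> vec_prod X Y \<longleftrightarrow> vec_left z \<in> X \<and> vec_right z \<in> Y"
  unfolding vec_prod_def mem_Collect_eq
  by (metis vec_join_left_right vec_left_join vec_right_join)

lemma continuous_on_vec_left: "continuous_on S vec_left"
  unfolding vec_left_def by (intro continuous_intros)

lemma continuous_on_vec_right: "continuous_on S vec_right"
  unfolding vec_right_def by (intro continuous_intros)

lemma continuous_on_vec_join: "continuous_on S (\<lambda>(x, y). vec_join x y)"
proof -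
  have "continuous_on S (\<lambda>z. case i of Inl j \<Rightarrow> fst z $ j | Inr j \<Rightarrow> snd z $ j)" for i
    by (cases i) (auto intro!: continuous_intros)
  thus ?thesis
    unfolding vec_join_def case_prod_unfold by (intro continuous_on_vec_lambda)
qed

lemma open_vec_prod:
  assumes "open X" "open Y"
  shows "open (vec_prod X Y)"
proof -
  have "vec_prod X Y = (vec_left -` X) \<inter> (vec_right -` Y)"
    by (auto simp: mem_vec_prod_iff)
  thus ?thesis
    using assms continuous_on_vec_left[of UNIV] continuous_on_vec_right[of UNIV]
    by (auto intro!: open_Int open_vimage)
qed

lemma supp_on_schwartz_bruhat:
  assumes "\<phi> \<in> schwartz_bruhat Z"
  shows "supp_on Z \<phi> = {x. \<phi> x \<noteq> 0}"
proof
  show "{x. \<phi> x \<noteq> 0} \<subseteq> supp_on Z \<phi>"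
    using assms closure_subset[of "{x \<in> Z. \<phi> x \<noteq> 0}"]
    unfolding supp_on_def schwartz_bruhat_def by blast
  show "supp_on Z \<phi> \<subseteq> {x. \<phi> x \<noteq> 0}"
  proof
    fix x assume "x \<in> supp_on Z \<phi>"
    hence x: "x \<in> Z" "x \<in> closure {x \<in> Z. \<phi> x \<noteq> 0}"
      by (simp_all add: supp_on_def)
    obtain U where U: "open U" "x \<in> U" "\<forall>y\<in>U \<inter> Z. \<phi> y = \<phi> x"
      using assms x(1) unfolding schwartz_bruhat_def by blast
    have "U \<inter> {x \<in> Z. \<phi> x \<noteq> 0} \<noteq> {}"
      using open_Int_closure_eq_empty[OF U(1)] U(2) x(2) by blast
    then obtain y where "y \<in> U \<inter> Z" "\<phi> y \<noteq> 0"
      by blast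
    with U(3) show "x \<in> {x. \<phi> x \<noteq> 0}"
      by simp
  qed
qed

lemma tensor_schwartz_bruhat:
  fixes X :: "('a::metric_space ^ 'm::finite) set" and Y :: "('a ^ 'n::finite) set"
  assumes \<phi>: "\<phi> \<in> schwartz_bruhat X" and \<psi>: "\<psi> \<in> schwartz_bruhat Y"
  shows "tensor \<phi> \<psi> \<in> schwartz_bruhat (vec_prod X Y)"
  unfolding schwartz_bruhat_def mem_Collect_eq
proof (intro conjI allI ballI impI)
  fix z assume "z \<notin> vec_prod X Y"
  thus "tensor \<phi> \<psi> z = 0"
    using \<phi> \<psi> by (auto simp: tensor_def mem_vec_prod_iff schwartz_bruhat_def)
next
  fix z assume "z \<in> vec_prod X Y"
  hence z: "vec_left z \<in> X" "vec_right z \<in> Y"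
    by (auto simp: mem_vec_prod_iff)
  obtain U where U: "open U" "vec_left z \<in> U" "\<forall>y\<in>U \<inter> X. \<phi> y = \<phi> (vec_left z)"
    using \<phi> z unfolding schwartz_bruhat_def by blast
  obtain V where V: "open V" "vec_right z \<in> V" "\<forall>y\<in>V \<inter> Y. \<psi> y = \<psi> (vec_right z)"
    using \<psi> z unfolding schwartz_bruhat_def by blast
  show "\<exists>W. open W \<and> z \<in> W \<and> (\<forall>y\<in>W \<inter> vec_prod X Y. tensor \<phi> \<psi> y = tensor \<phi> \<psi> z)"
    using U V open_vec_prod[OF U(1) V(1)]
    by (intro exI[of _ "vec_prod U V"]) (auto simp: mem_vec_prod_iff tensor_def)
next
  let ?S = "(\<lambda>(x, y). vec_join x y) ` ({x. \<phi> x \<noteq> 0} \<times> {y. \<psi> y \<noteq> 0})"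
  have "compact {x. \<phi> x \<noteq> 0}" "compact {y. \<psi> y \<noteq> 0}"
    using \<phi> \<psi> supp_on_schwartz_bruhat[OF \<phi>] supp_on_schwartz_bruhat[OF \<psi>]
    by (auto simp: schwartz_bruhat_def)
  hence S: "compact ?S"
    by (intro compact_continuous_image continuous_on_vec_join compact_Times)
  have "{z \<in> vec_prod X Y. tensor \<phi> \<psi> z \<noteq> 0} = ?S"
  proof (intro equalityI subsetI)
    fix z assume "z \<in> {z \<in> vec_prod X Y. tensor \<phi> \<psi> z \<noteq> 0}"
    thus "z \<in> ?S"
      by (intro image_eqI[of _ _ "(vec_left z, vec_right z)"]) (auto simp: tensor_def)
  next
    fix z assume "z \<in> ?S"
    thus "z \<in> {z \<in> vec_prod X Y. tensor \<phi> \<psi> z \<noteq> 0}"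
      using \<phi> \<psi> by (auto simp: tensor_def mem_vec_prod_iff schwartz_bruhat_def)
  qed
  moreover from this have "?S \<subseteq> vec_prod X Y"
    by blast
  ultimately have "supp_on (vec_prod X Y) (tensor \<phi> \<psi>) = ?S"
    using S compact_imp_closed[OF S] by (simp add: supp_on_def closure_closed Int_absorb1)
  thus "compact (supp_on (vec_prod X Y) (tensor \<phi> \<psi>))"
    using S by simp
qed

lemma schwartz_bruhat_scale:
  assumes "\<phi> \<in> schwartz_bruhat Z"
  shows "(\<lambda>x. c * \<phi> x) \<in> schwartz_bruhat Z"
proof (cases "c = 0")
  case True
  thus ?thesis
    by (auto simp: schwartz_bruhat_def supp_on_def)
next
  case False
  hence "supp_on Z (\<lambda>x. c * \<phi> x) = supp_on Z \<phi>"
    by (simp add: supp_on_def)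
  thus ?thesis
    using assms False by (simp add: schwartz_bruhat_def)
qed

lemma schwartz_bruhat_add:
  fixes Z :: "'a::t2_space set"
  assumes \<phi>: "\<phi> \<in> schwartz_bruhat Z" and \<psi>: "\<psi> \<in> schwartz_bruhat Z"
  shows "(\<lambda>x. \<phi> x + \<psi> x) \<in> schwartz_bruhat Z"
  unfolding schwartz_bruhat_def mem_Collect_eq
proof (intro conjI allI ballI impI)
  fix x assume "x \<notin> Z"
  thus "\<phi> x + \<psi> x = 0"
    using \<phi> \<psi> by (auto simp: schwartz_bruhat_def)
next
  fix x assume x: "x \<in> Z"
  obtain U where U: "open U" "x \<in> U" "\<forall>y\<in>U \<inter> Z. \<phi> y = \<phi> x"
    using \<phi> x unfolding schwartz_bruhat_def by blast
  obtain V where V: "open V" "x \<in> V" "\<forall>y\<in>V \<inter> Z. \<psi> y = \<psi> x"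
    using \<psi> x unfolding schwartz_bruhat_def by blast
  show "\<exists>U. open U \<and> x \<in> U \<and> (\<forall>y\<in>U \<inter> Z. \<phi> y + \<psi> y = \<phi> x + \<psi> x)"
    using U V by (intro exI[of _ "U \<inter> V"]) auto
next
  let ?C = "supp_on Z \<phi> \<union> supp_on Z \<psi>"
  let ?S = "closure {x \<in> Z. \<phi> x + \<psi> x \<noteq> 0}"
  have C: "compact ?C" "?C \<subseteq> Z"
    using \<phi> \<psi> by (auto simp: schwartz_bruhat_def supp_on_def)
  have "{x \<in> Z. \<phi> x + \<psi> x \<noteq> 0} \<subseteq> ?C"
    by (auto simp: supp_on_schwartz_bruhat[OF \<phi>] supp_on_schwartz_bruhat[OF \<psi>])
  hence "?S \<subseteq> ?C"
    using C by (intro closure_minimal compact_imp_closed)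
  hence "supp_on Z (\<lambda>x. \<phi> x + \<psi> x) = ?C \<inter> ?S"
    using C by (auto simp: supp_on_def)
  thus "compact (supp_on Z (\<lambda>x. \<phi> x + \<psi> x))"
    using C by (simp add: compact_Int_closed)
qed

lemma ex1_kernel:
  fixes X :: "('a::metric_space ^ 'm::finite) set" and Y :: "('a ^ 'n::finite) set"
  assumes u: "u \<in> distributions (vec_prod X Y)"
  shows "\<exists>!K. is_kernel X Y u K"
proof (rule ex_ex1I)
  let ?SX = "schwartz_bruhat X" and ?SY = "schwartz_bruhat Y"
  let ?K = "restrict (\<lambda>\<psi>. restrict (\<lambda>\<phi>. u (tensor \<phi> \<psi>)) ?SX) ?SY"
  have add: "u (\<lambda>z. f z + g z) = u f + u g"
    if "f \<in> schwartz_bruhat (vec_prod X Y)" "g \<in> schwartz_bruhat (vec_prod X Y)" for f g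
    using u that by (simp add: distributions_def)
  have scale: "u (\<lambda>z. c * f z) = c * u f"
    if "f \<in> schwartz_bruhat (vec_prod X Y)" for f c
    using u that by (simp add: distributions_def)
  have t: "tensor (\<lambda>x. \<phi> x + \<phi>' x) \<psi> = (\<lambda>z. tensor \<phi> \<psi> z + tensor \<phi>' \<psi> z)"
    "tensor \<phi> (\<lambda>x. \<psi> x + \<psi>' x) = (\<lambda>z. tensor \<phi> \<psi> z + tensor \<phi> \<psi>' z)"
    "tensor (\<lambda>x. c * \<phi> x) \<psi> = (\<lambda>z. c * tensor \<phi> \<psi> z)"
    "tensor \<phi> (\<lambda>x. c * \<psi> x) = (\<lambda>z. c * tensor \<phi> \<psi> z)"
    for \<phi> \<phi>' :: "'a ^ 'm \<Rightarrow> complex" and \<psi> \<psi>' :: "'a ^ 'n \<Rightarrow> complex" and c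
    by (auto simp: tensor_def fun_eq_iff algebra_simps)
  note sb = schwartz_bruhat_add schwartz_bruhat_scale tensor_schwartz_bruhat
  have "?K \<in> ?SY \<rightarrow>\<^sub>E distributions X"
  proof (rule PiE_I)
    fix \<psi> assume \<psi>: "\<psi> \<in> ?SY"
    show "?K \<psi> \<in> distributions X"
      using \<psi> by (simp add: distributions_def sb t add scale)
  qed simp
  thus "\<exists>K. is_kernel X Y u K"
    by (intro exI[of _ ?K]) (simp add: is_kernel_def sb t add scale)
next
  fix K L assume K: "is_kernel X Y u K" and L: "is_kernel X Y u L"
  show "K = L"
  proof (rule PiE_ext)
    show KL: "K \<in> schwartz_bruhat Y \<rightarrow>\<^sub>E distributions X" "L \<in> schwartz_bruhat Y \<rightarrow>\<^sub>E distributions X"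
      using K L by (auto simp: is_kernel_def)
    fix \<psi> assume \<psi>: "\<psi> \<in> schwartz_bruhat Y"
    have "K \<psi> \<in> distributions X" "L \<psi> \<in> distributions X"
      using KL \<psi> by blast+
    hence "K \<psi> \<in> extensional (schwartz_bruhat X)" "L \<psi> \<in> extensional (schwartz_bruhat X)"
      by (auto simp: distributions_def)
    thus "K \<psi> = L \<psi>"
      by (rule extensionalityI) (use K L \<psi> in \<open>auto simp: is_kernel_def\<close>)
  qed
qed


section \<open>Wave front sets\<close>

text \<open>Continuity is automatic, since the character is trivial on an open subgroup.\<close>

definition additive_character :: "('p::prime_card padic \<Rightarrow> complex) \<Rightarrow> bool" where
  "additive_character \<Psi> \<longleftrightarrow>
     (\<forall>x. \<Psi> x \<noteq> 0) \<and> (\<forall>x y. \<Psi> (x + y) = \<Psi> x * \<Psi> y) \<and>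
     (\<exists>x\<in>padic_integers. \<Psi> x \<noteq> 1) \<and> (\<forall>x\<in>padic_integers. \<Psi> (of_nat CARD('p) * x) = 1)"

definition open_finite_index_subgroup :: "'p::prime_card padic set \<Rightarrow> bool" where
  "open_finite_index_subgroup \<Lambda> \<longleftrightarrow>
     open \<Lambda> \<and> \<Lambda> \<subseteq> - {0} \<and> 1 \<in> \<Lambda> \<and>
     (\<forall>x\<in>\<Lambda>. \<forall>y\<in>\<Lambda>. x * y \<in> \<Lambda>) \<and> (\<forall>x\<in>\<Lambda>. inverse x \<in> \<Lambda>) \<and>
     finite ((\<lambda>a. (*) a ` \<Lambda>) ` (- {0}))"

definition std_bilinear :: "'a::comm_semiring_0 ^ 'k::finite \<Rightarrow> 'a ^ 'k \<Rightarrow> 'a" where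
  "std_bilinear x y = (\<Sum>i\<in>UNIV. x $ i * y $ i)"

definition microlocally_smooth ::
    "('p::prime_card padic \<Rightarrow> complex) \<Rightarrow> 'p padic set \<Rightarrow> ('p padic ^ 'k::finite) set \<Rightarrow>
     (('p padic ^ 'k \<Rightarrow> complex) \<Rightarrow> complex) \<Rightarrow> 'p padic ^ 'k \<Rightarrow> 'p padic ^ 'k \<Rightarrow> bool" where
  "microlocally_smooth \<Psi> \<Lambda> Z u x0 \<xi>0 \<longleftrightarrow>
     (\<exists>U V. open U \<and> x0 \<in> U \<and> U \<subseteq> Z \<and> open V \<and> \<xi>0 \<in> V \<and> V \<subseteq> - {0} \<and>
        (\<forall>\<phi>\<in>schwartz_bruhat Z. supp_on Z \<phi> \<subseteq> U \<longrightarrow>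
           (\<exists>N::int. \<forall>l\<in>\<Lambda>. padic_ord l < N \<longrightarrow>
              (\<forall>\<xi>\<in>V. u (\<lambda>x. \<phi> x * \<Psi> (std_bilinear x (l *s \<xi>))) = 0))))"

definition wave_front_set ::
    "('p::prime_card padic \<Rightarrow> complex) \<Rightarrow> 'p padic set \<Rightarrow> ('p padic ^ 'k::finite) set \<Rightarrow>
     (('p padic ^ 'k \<Rightarrow> complex) \<Rightarrow> complex) \<Rightarrow> (('p padic ^ 'k) \<times> ('p padic ^ 'k)) set" where
  "wave_front_set \<Psi> \<Lambda> Z u =
     {(x, \<xi>). x \<in> Z \<and> \<xi> \<noteq> 0 \<and> \<not> microlocally_smooth \<Psi> \<Lambda> Z u x \<xi>}"

end

theory Submission
  imports Defs
begin

text \<open>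
  If \<open>u\<close> is microlocally smooth at \<open>((x, y), (\<xi>, 0))\<close>, then \<open>\<K>\<psi>'\<close> is microlocally smooth at
  \<open>(x, \<xi>)\<close> for every \<open>\<psi>'\<close> supported in a small clopen box around \<open>y\<close>, because
  \<open>(\<phi> \<otimes> \<psi>') \<cdot> \<Psi>(\<langle>\<cdot>, (\<lambda>\<xi>, 0)\<rangle>) = (\<phi> \<cdot> \<Psi>(\<langle>\<cdot>, \<lambda>\<xi>\<rangle>)) \<otimes> \<psi>'\<close>. Finitely many of these boxes cover the
  compact support of \<open>\<psi>\<close>; cutting \<open>\<psi>\<close> along them writes \<open>\<K>\<psi>\<close> as a finite sum of distributions
  that are microlocally smooth at \<open>(x, \<xi>)\<close>.
\<close>

section \<open>Local constancy of the additive character\<close>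

text \<open>\<open>of_nat n\<close> is the class of the constant sequence n, and the norm of a class
  is the limit of the rational absolute values. For n = p this shows that p has nonzero
  norm.\<close>

lemma padic_norm_of_nat:
  "padic_norm (of_nat n :: 'p::prime_card padic) = rat_padic_abs CARD('p) (of_nat n)"
proof -
  have of_nat: "(of_nat n :: 'p padic) = padic_of_seq (\<lambda>_. of_nat n)"
  proof (induction n)
    case 0
    show ?case
      by (simp add: zero_padic_def)
  next
    case (Suc n)
    have "(of_nat (Suc n) :: 'p padic) = padic_of_seq (\<lambda>_. 1) + padic_of_seq (\<lambda>_. of_nat n)"
      by (simp add: Suc one_padic_def)
    also have "\<dots> = padic_of_seq (\<lambda>_. of_nat (Suc n))"
      by (subst plus_padic.abs_eq) (simp_all add: padic_rel_refl)
    finally show ?case .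
  qed
  show ?thesis
    unfolding of_nat by (subst padic_norm.abs_eq) (simp_all add: padic_rel_refl limI)
qed

lemma padic_norm_prime_pos: "padic_norm (of_nat CARD('p) :: 'p::prime_card padic) > 0"
proof -
  have "padic_norm (of_nat CARD('p) :: 'p padic) \<noteq> 0"
    unfolding padic_norm_of_nat
    by (simp add: rat_padic_abs_eq_0_iff[OF prime_card[where 'a = 'p]])
  thus ?thesis
    using padic_norm_nonneg[of "of_nat CARD('p) :: 'p padic"] by linarith
qed

text \<open>The closed ball of radius |p| around 0 is p times the ring of integers: x = p (x / p),
  where x / p has norm at most 1. On that set \<open>\<Psi>\<close> is trivial by
  assumption.\<close>

lemma additive_character_eq_1:
  fixes \<Psi> :: "'p::prime_card padic \<Rightarrow> complex"
  assumes \<Psi>: "additive_character \<Psi>"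
    and x: "padic_norm x \<le> padic_norm (of_nat CARD('p) :: 'p padic)"
  shows "\<Psi> x = 1"
proof -
  let ?p = "of_nat CARD('p) :: 'p padic"
  have pos: "padic_norm ?p > 0"
    by (rule padic_norm_prime_pos)
  hence "?p \<noteq> 0"
    by (metis less_irrefl padic_norm_0)
  hence eq: "x = ?p * (x / ?p)"
    by simp
  hence "padic_norm x = padic_norm ?p * padic_norm (x / ?p)"
    by (metis padic_norm_mult)
  hence "x / ?p \<in> padic_integers"
    using x pos by (simp add: padic_integers_def)
  hence "\<Psi> (?p * (x / ?p)) = 1"
    using \<Psi> unfolding additive_character_def by blast
  thus ?thesis
    using eq by simp
qed

text \<open>\<open>\<Psi> b = \<Psi> (b - a) * \<Psi> a\<close>, and the first factor is 1 on the
  ball of radius |p| around a.\<close>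

lemma additive_character_locally_constant:
  fixes \<Psi> :: "'p::prime_card padic \<Rightarrow> complex"
  assumes \<Psi>: "additive_character \<Psi>"
  shows "\<exists>U. open U \<and> a \<in> U \<and> (\<forall>b\<in>U. \<Psi> b = \<Psi> a)"
proof (intro exI conjI ballI)
  let ?U = "ball a (padic_norm (of_nat CARD('p) :: 'p padic))"
  show "open ?U" "a \<in> ?U"
    using padic_norm_prime_pos by auto
  fix b assume "b \<in> ?U"
  hence "\<Psi> (b - a) = 1"
    using \<Psi> by (intro additive_character_eq_1) (auto simp: dist_commute dist_padic_def[symmetric])
  moreover have "\<Psi> b = \<Psi> (b - a) * \<Psi> a"
    using \<Psi> unfolding additive_character_def by (metis diff_add_cancel)
  ultimately show "\<Psi> b = \<Psi> a"
    by simp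
qed

section \<open>Continuity of the standard bilinear form\<close>

text \<open>Multiplication by c scales every distance by \<open>padic_norm c\<close>.\<close>

lemma isCont_mult_right_padic: "isCont (\<lambda>x. x * c) (a :: 'p::prime_card padic)"
proof -
  have "dist (x * c) (a * c) = dist x a * padic_norm c" for x
    by (simp add: dist_padic_def flip: padic_norm_mult left_diff_distrib)
  moreover have "((\<lambda>x. dist x a * padic_norm c) \<longlongrightarrow> dist a a * padic_norm c) (at a)"
    by (intro tendsto_intros)
  ultimately show ?thesis
    by (subst isCont_def, subst tendsto_dist_iff) simp
qed

lemma dist_padic_le_max: "dist x z \<le> max (dist x y) (dist y (z :: 'p::prime_card padic))"
  using padic_norm_add_le_max[of "x - y" "y - z"] by (simp add: dist_padic_def)

text \<open>The ultrametric bound by a maximum is weakened to a sum, the form in which it serves as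
  a null majorant for the continuity of addition.\<close>

lemma dist_padic_add: "dist (a + b) (c + d) \<le> dist a c + dist b (d :: 'p::prime_card padic)"
proof -
  have "dist (a + b) (c + d) \<le> max (dist a c) (dist b d)"
    using padic_norm_add_le_max[of "a - c" "b - d"] by (simp add: dist_padic_def algebra_simps)
  thus ?thesis
    using zero_le_dist[of a c] zero_le_dist[of b d] by linarith
qed

lemma continuous_on_padic_add:
  fixes f g :: "'a::topological_space \<Rightarrow> 'p::prime_card padic"
  assumes "continuous_on S f" "continuous_on S g"
  shows "continuous_on S (\<lambda>x. f x + g x)"
  unfolding continuous_on_def
proof
  fix a assume a: "a \<in> S"
  have fg: "(f \<longlongrightarrow> f a) (at a within S)" "(g \<longlongrightarrow> g a) (at a within S)"
    using assms a by (auto simp: continuous_on_def)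
  have "((\<lambda>x. dist (f x) (f a) + dist (g x) (g a)) \<longlongrightarrow> 0 + 0) (at a within S)"
    using fg by (intro tendsto_add) (simp_all flip: tendsto_dist_iff)
  hence "((\<lambda>x. dist (f x + g x) (f a + g a)) \<longlongrightarrow> 0) (at a within S)"
    using Lim_null_comparison[of "\<lambda>x. dist (f x + g x) (f a + g a)"
        "\<lambda>x. dist (f x) (f a) + dist (g x) (g a)" "at a within S"]
    by (simp add: dist_padic_add)
  thus "((\<lambda>x. f x + g x) \<longlongrightarrow> f a + g a) (at a within S)"
    by (subst tendsto_dist_iff)
qed

lemma continuous_on_std_bilinear:
  fixes \<eta> :: "'p::prime_card padic ^ 'k::finite"
  shows "continuous_on S (\<lambda>x. std_bilinear x \<eta>)"
proof -
  have "continuous_on S (\<lambda>x. \<Sum>i\<in>I. x $ i * \<eta> $ i)" if "finite I" for I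
    using that
  proof induction
    case (insert i I)
    have "continuous_on S (\<lambda>x. x $ i * \<eta> $ i)"
      by (rule continuous_on_compose2[of UNIV "\<lambda>a. a * \<eta> $ i"])
        (auto intro!: continuous_at_imp_continuous_on isCont_mult_right_padic
          continuous_on_component continuous_on_id)
    thus ?case
      using insert by (simp add: continuous_on_padic_add)
  qed simp
  thus ?thesis
    by (simp add: std_bilinear_def)
qed

lemma character_locally_constant:
  fixes \<Psi> :: "'p::prime_card padic \<Rightarrow> complex" and x :: "'p padic ^ 'k::finite"
  assumes "additive_character \<Psi>"
  shows "\<exists>U. open U \<and> x \<in> U \<and>
    (\<forall>y\<in>U. \<Psi> (std_bilinear y \<eta>) = \<Psi> (std_bilinear x \<eta>))"
proof -
  obtain U where U: "open U" "std_bilinear x \<eta> \<in> U" "\<forall>b\<in>U. \<Psi> b = \<Psi> (std_bilinear x \<eta>)"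
    using additive_character_locally_constant[OF assms] by blast
  have "open ((\<lambda>y. std_bilinear y \<eta>) -` U)"
    using U(1) continuous_on_std_bilinear by (rule open_vimage)
  thus ?thesis
    using U by blast
qed

section \<open>Multiplying Schwartz--Bruhat functions by locally constant functions\<close>

text \<open>A factor g can only shrink the support, and a closed part of a compact set is compact.
  This covers both uses: g a character, for modulating test functions, and g the indicator of a
  clopen set, for cutting them.\<close>

lemma schwartz_bruhat_mult_locally_constant:
  fixes Z :: "'a::t2_space set"
  assumes \<phi>: "\<phi> \<in> schwartz_bruhat Z"
    and g: "\<And>x. \<exists>U. open U \<and> x \<in> U \<and> (\<forall>y\<in>U. g y = g x)"
  shows "(\<lambda>x. \<phi> x * g x) \<in> schwartz_bruhat Z"
  unfolding schwartz_bruhat_def mem_Collect_eq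
proof (intro conjI allI ballI impI)
  fix x assume "x \<notin> Z"
  thus "\<phi> x * g x = 0"
    using \<phi> by (auto simp: schwartz_bruhat_def)
next
  fix x assume x: "x \<in> Z"
  obtain U where U: "open U" "x \<in> U" "\<forall>y\<in>U \<inter> Z. \<phi> y = \<phi> x"
    using \<phi> x unfolding schwartz_bruhat_def by blast
  obtain V where V: "open V" "x \<in> V" "\<forall>y\<in>V. g y = g x"
    using g by blast
  show "\<exists>U. open U \<and> x \<in> U \<and> (\<forall>y\<in>U \<inter> Z. \<phi> y * g y = \<phi> x * g x)"
  proof (intro exI conjI ballI)
    show "open (U \<inter> V)" "x \<in> U \<inter> V"
      using U V by auto
    fix y assume "y \<in> U \<inter> V \<inter> Z"
    hence "\<phi> y = \<phi> x" "g y = g x"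
      using U V by blast+
    thus "\<phi> y * g y = \<phi> x * g x"
      by simp
  qed
next
  let ?S = "closure {x \<in> Z. \<phi> x * g x \<noteq> 0}"
  have C: "compact (supp_on Z \<phi>)" "supp_on Z \<phi> \<subseteq> Z"
    using \<phi> by (auto simp: schwartz_bruhat_def supp_on_def)
  have "{x \<in> Z. \<phi> x * g x \<noteq> 0} \<subseteq> supp_on Z \<phi>"
    by (auto simp: supp_on_schwartz_bruhat[OF \<phi>])
  \<comment> \<open>The closure is taken in the whole space; it cannot leave Z because the support
    of \<open>\<phi>\<close>, being compact, is closed there too.\<close>
  hence "?S \<subseteq> supp_on Z \<phi>"
    using C by (intro closure_minimal compact_imp_closed)
  hence "supp_on Z (\<lambda>x. \<phi> x * g x) = supp_on Z \<phi> \<inter> ?S"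
    using C by (auto simp: supp_on_def)
  thus "compact (supp_on Z (\<lambda>x. \<phi> x * g x))"
    using C by (simp add: compact_Int_closed)
qed

text \<open>The indicator is constant on C and on its complement, both of which are open.\<close>

lemma schwartz_bruhat_mult_indicator:
  fixes Z :: "'a::t2_space set"
  assumes "\<phi> \<in> schwartz_bruhat Z" and C: "open C" "closed C"
  shows "(\<lambda>x. \<phi> x * indicator C x) \<in> schwartz_bruhat Z"
proof (rule schwartz_bruhat_mult_locally_constant[OF assms(1)])
  fix x
  show "\<exists>U. open U \<and> x \<in> U \<and>
    (\<forall>y\<in>U. indicator C y = (indicator C x :: complex))"
  proof (cases "x \<in> C")
    case True
    thus ?thesis
      using C by (intro exI[of _ C]) simp
  next
    case False
    thus ?thesis
      using C by (intro exI[of _ "- C"]) (simp add: open_Compl)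
  qed
qed

section \<open>Clopen neighbourhoods\<close>

text \<open>In an ultrametric space the complement of a ball of radius r > 0 is a union of balls of
  radius r: a point at distance less than r from a point outside is itself outside.\<close>

lemma closed_ball_padic: "closed (ball (a :: 'p::prime_card padic) r)"
proof -
  have "- ball a r = (\<Union>b\<in>- ball a r. ball b r)" if "r > 0"
  proof (intro equalityI subsetI)
    fix c assume "c \<in> (\<Union>b\<in>- ball a r. ball b r)"
    then obtain b where b: "dist a b \<ge> r" "dist b c < r"
      by (auto simp: not_less)
    thus "c \<in> - ball a r"
      using dist_padic_le_max[of a b c] by (auto simp: dist_commute)
  next
    fix c assume "c \<in> - ball a r"
    thus "c \<in> (\<Union>b\<in>- ball a r. ball b r)"
      using that by (intro UN_I[of c]) simp_all
  qed
  hence "open (- ball a r)" if "r > 0"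
    using that by (metis open_UN open_ball)
  thus ?thesis
    by (cases "r > 0") (auto simp: closed_def ball_empty)
qed

text \<open>Open sets of the product topology contain boxes; shrinking each side to a ball makes the
  box clopen.\<close>

lemma clopen_neighbourhood_padic_vec:
  fixes y :: "'p::prime_card padic ^ 'k::finite"
  assumes "open B" "y \<in> B"
  obtains C where "open C" "closed C" "y \<in> C" "C \<subseteq> B"
proof -
  obtain A where A: "\<And>i. open (A i) \<and> y $ i \<in> A i" "\<And>z. \<forall>i. z $ i \<in> A i \<Longrightarrow> z \<in> B"
    using assms unfolding open_vec_def by metis
  have "\<exists>e>0. ball (y $ i) e \<subseteq> A i" for i
    using A(1)[of i] by (auto elim: openE)
  then obtain r where r: "\<And>i. r i > 0" "\<And>i. ball (y $ i) (r i) \<subseteq> A i"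
    by metis
  let ?C = "{z. \<forall>i. z $ i \<in> ball (y $ i) (r i)}"
  show thesis
  proof
    show "open ?C"
      by (rule open_vector_box) simp
    show "closed ?C"
      by (rule closed_vector_box) (simp add: closed_ball_padic)
    show "y \<in> ?C" "?C \<subseteq> B"
      using r A(2) by (auto simp: subset_iff)
  qed
qed

section \<open>Covectors with second component 0, and stability of microlocal smoothness\<close>

text \<open>The second block contributes nothing to the sum, so a character with covector
  \<open>(l \<xi>, 0)\<close> can be absorbed into the first factor of a tensor product.\<close>

lemma std_bilinear_vec_join_0:
  fixes z :: "'a::comm_semiring_1 ^ ('m::finite + 'n::finite)"
  shows "std_bilinear z (l *s vec_join \<xi> 0) = std_bilinear (vec_left z) (l *s \<xi>)"
  unfolding std_bilinear_def UNIV_Plus_UNIV[symmetric]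
  by (subst sum.Plus) (simp_all add: vec_join_def vec_left_def)

text \<open>Base case for sums of pieces. Z and the complement of the origin serve as
  neighbourhoods, and any N works; u vanishes on the modulated functions because these are again
  Schwartz--Bruhat.\<close>

lemma microlocally_smooth_zero:
  fixes x \<xi> :: "'a::prime_card padic ^ 'b::finite"
  assumes "open Z" "x \<in> Z" "\<xi> \<noteq> 0" and \<Psi>: "additive_character \<Psi>"
    and "\<And>\<phi>. \<phi> \<in> schwartz_bruhat Z \<Longrightarrow> u \<phi> = 0"
  shows "microlocally_smooth \<Psi> \<Lambda> Z u x \<xi>"
proof -
  have "u (\<lambda>x. \<phi> x * \<Psi> (std_bilinear x (l *s \<xi>))) = 0"
    if "\<phi> \<in> schwartz_bruhat Z" for \<phi> l \<xi>
    using that \<Psi> assms(5)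
    by (simp add: schwartz_bruhat_mult_locally_constant character_locally_constant)
  moreover have "open (- {0 :: 'a padic ^ 'b})"
    by (simp add: open_Compl)
  ultimately show ?thesis
    unfolding microlocally_smooth_def using assms(1-3)
    by (intro exI[of _ Z] exI[of _ "- {0 :: 'a padic ^ 'b}"]) simp
qed

text \<open>Intersect the neighbourhoods and take the smaller of the two thresholds. The relation
  between w, u and v is given on test functions, so the modulated \<open>\<phi>\<close> has to be
  recognised as one.\<close>

lemma microlocally_smooth_add:
  assumes u: "microlocally_smooth \<Psi> \<Lambda> Z u x \<xi>" and v: "microlocally_smooth \<Psi> \<Lambda> Z v x \<xi>"
    and w: "\<And>\<phi>. \<phi> \<in> schwartz_bruhat Z \<Longrightarrow> w \<phi> = u \<phi> + v \<phi>"
    and \<Psi>: "additive_character \<Psi>"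
  shows "microlocally_smooth \<Psi> \<Lambda> Z w x \<xi>"
proof -
  let ?e = "\<lambda>\<phi> l \<xi> x. \<phi> x * \<Psi> (std_bilinear x (l *s \<xi>))"
  obtain U V where U: "open U" "x \<in> U" "U \<subseteq> Z" "open V" "\<xi> \<in> V" "V \<subseteq> - {0}"
    and Us: "\<forall>\<phi>\<in>schwartz_bruhat Z. supp_on Z \<phi> \<subseteq> U \<longrightarrow>
      (\<exists>N::int. \<forall>l\<in>\<Lambda>. padic_ord l < N \<longrightarrow> (\<forall>\<xi>\<in>V. u (?e \<phi> l \<xi>) = 0))"
    using u unfolding microlocally_smooth_def by (elim exE conjE) (rule that; assumption)
  obtain U' V' where U': "open U'" "x \<in> U'" "open V'" "\<xi> \<in> V'"
    and Us': "\<forall>\<phi>\<in>schwartz_bruhat Z. supp_on Z \<phi> \<subseteq> U' \<longrightarrow>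
      (\<exists>N::int. \<forall>l\<in>\<Lambda>. padic_ord l < N \<longrightarrow> (\<forall>\<xi>\<in>V'. v (?e \<phi> l \<xi>) = 0))"
    using v unfolding microlocally_smooth_def by (elim exE conjE) (rule that; assumption)
  have "\<exists>N::int. \<forall>l\<in>\<Lambda>. padic_ord l < N \<longrightarrow> (\<forall>\<xi>\<in>V \<inter> V'. w (?e \<phi> l \<xi>) = 0)"
    if \<phi>: "\<phi> \<in> schwartz_bruhat Z" "supp_on Z \<phi> \<subseteq> U \<inter> U'" for \<phi>
  proof -
    obtain N where N: "\<forall>l\<in>\<Lambda>. padic_ord l < N \<longrightarrow> (\<forall>\<xi>\<in>V. u (?e \<phi> l \<xi>) = 0)"
      using Us \<phi> by (meson le_inf_iff)
    obtain N' where N': "\<forall>l\<in>\<Lambda>. padic_ord l < N' \<longrightarrow> (\<forall>\<xi>\<in>V'. v (?e \<phi> l \<xi>) = 0)"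
      using Us' \<phi> by (meson le_inf_iff)
    have "?e \<phi> l \<xi> \<in> schwartz_bruhat Z" for l \<xi>
      using \<phi>(1) character_locally_constant[OF \<Psi>]
      by (rule schwartz_bruhat_mult_locally_constant)
    thus ?thesis
      using N N' w by (intro exI[of _ "min N N'"]) simp
  qed
  thus ?thesis
    unfolding microlocally_smooth_def using U U'
    by (intro exI[of _ "U \<inter> U'"] exI[of _ "V \<inter> V'"]) auto
qed

section \<open>From local to global smoothness of the kernel\<close>

text \<open>The set C depends on y but not on \<open>\<psi>\<close>, so one choice serves every
  piece supported in it. It is clopen so that \<open>\<psi>\<close> can later be cut along
  it.\<close>

lemma kernel_microlocally_smooth_local:
  fixes X :: "('p::prime_card padic ^ 'm::finite) set" and Y :: "('p padic ^ 'n::finite) set"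
  assumes \<Psi>: "additive_character \<Psi>" and X: "open X" "x \<in> X"
    and K: "is_kernel X Y u K"
    and u: "microlocally_smooth \<Psi> \<Lambda> (vec_prod X Y) u (vec_join x y) (vec_join \<xi> 0)"
  obtains C where "open C" "closed C" "y \<in> C"
    "\<And>\<psi>. \<psi> \<in> schwartz_bruhat Y \<Longrightarrow> {y. \<psi> y \<noteq> 0} \<subseteq> C \<Longrightarrow>
      microlocally_smooth \<Psi> \<Lambda> X (K \<psi>) x \<xi>"
proof -
  let ?Z = "vec_prod X Y"
  let ?join = "\<lambda>(x, y). vec_join x y :: 'p padic ^ ('m + 'n)"
  obtain U V where U: "open U" "vec_join x y \<in> U"
    and V: "open V" "vec_join \<xi> 0 \<in> V" "V \<subseteq> - {0}"
    and UV: "\<forall>\<phi>\<in>schwartz_bruhat ?Z. supp_on ?Z \<phi> \<subseteq> U \<longrightarrow>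
      (\<exists>N::int. \<forall>l\<in>\<Lambda>. padic_ord l < N \<longrightarrow>
        (\<forall>\<xi>\<in>V. u (\<lambda>z. \<phi> z * \<Psi> (std_bilinear z (l *s \<xi>))) = 0))"
    using u unfolding microlocally_smooth_def by (elim exE conjE) (rule that; assumption)
  \<comment> \<open>Seen as sets of pairs, U and V contain open rectangles around (x, y) and
    \<open>(\<xi>, 0)\<close>; the slice of the second one at 0 yields the neighbourhood D of
    \<open>\<xi>\<close>.\<close>
  have "open (?join -` U)" "open (?join -` V)"
    using U(1) V(1) continuous_on_vec_join by (auto intro: open_vimage)
  moreover have "(x, y) \<in> ?join -` U" "(\<xi>, 0) \<in> ?join -` V"
    using U(2) V(2) by auto
  ultimately obtain A B D E where
    A: "open A" "open B" "(x, y) \<in> A \<times> B" "A \<times> B \<subseteq> ?join -` U" and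
    D: "open D" "(\<xi>, 0) \<in> D \<times> E" "D \<times> E \<subseteq> ?join -` V"
    by (metis open_prod_elim)
  obtain C where C: "open C" "closed C" "y \<in> C" "C \<subseteq> B"
    using clopen_neighbourhood_padic_vec[OF A(2)] A(3) by blast
  have joinV: "vec_join \<xi>' 0 \<in> V" if "\<xi>' \<in> D" for \<xi>'
    using D that by auto
  \<comment> \<open>Hence D avoids the origin: 0 in D would put the origin into V.\<close>
  have "vec_join 0 0 = (0 :: 'p padic ^ ('m + 'n))"
    by (simp add: vec_join_def vec_eq_iff split: sum.split)
  hence D0: "D \<subseteq> - {0}"
    using joinV V(3) by force
  have "microlocally_smooth \<Psi> \<Lambda> X (K \<psi>) x \<xi>"
    if \<psi>: "\<psi> \<in> schwartz_bruhat Y" "{y. \<psi> y \<noteq> 0} \<subseteq> C" for \<psi>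
  proof -
    have "\<exists>N::int. \<forall>l\<in>\<Lambda>. padic_ord l < N \<longrightarrow>
        (\<forall>\<xi>\<in>D. K \<psi> (\<lambda>x. \<phi> x * \<Psi> (std_bilinear x (l *s \<xi>))) = 0)"
      if \<phi>: "\<phi> \<in> schwartz_bruhat X" "supp_on X \<phi> \<subseteq> A \<inter> X" for \<phi>
    proof -
      have T: "tensor \<phi> \<psi> \<in> schwartz_bruhat ?Z"
        using \<phi>(1) \<psi>(1) by (rule tensor_schwartz_bruhat)
      have "z \<in> U" if "tensor \<phi> \<psi> z \<noteq> 0" for z
      proof -
        have "vec_left z \<in> A" "vec_right z \<in> B"
          using that \<phi>(2) \<psi>(2) C(4) supp_on_schwartz_bruhat[OF \<phi>(1)] by (auto simp: tensor_def)
        hence "(vec_left z, vec_right z) \<in> ?join -` U"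
          using A(4) by blast
        thus ?thesis
          by simp
      qed
      hence "supp_on ?Z (tensor \<phi> \<psi>) \<subseteq> U"
        unfolding supp_on_schwartz_bruhat[OF T] by blast
      then obtain N where N: "\<forall>l\<in>\<Lambda>. padic_ord l < N \<longrightarrow>
          (\<forall>\<xi>\<in>V. u (\<lambda>z. tensor \<phi> \<psi> z * \<Psi> (std_bilinear z (l *s \<xi>))) = 0)"
        using UV T by meson
      \<comment> \<open>The character moves inside the tensor product, so the threshold N found for
        \<open>tensor \<phi> \<psi>\<close> also works for \<open>\<phi>\<close> and
        \<open>K \<psi>\<close>.\<close>
      have "K \<psi> (\<lambda>x. \<phi> x * \<Psi> (std_bilinear x (l *s \<xi>))) =
          u (\<lambda>z. tensor \<phi> \<psi> z * \<Psi> (std_bilinear z (l *s vec_join \<xi> 0)))" for l \<xi>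
      proof -
        let ?\<phi> = "\<lambda>x. \<phi> x * \<Psi> (std_bilinear x (l *s \<xi>))"
        have "?\<phi> \<in> schwartz_bruhat X"
          using \<phi>(1) character_locally_constant[OF \<Psi>]
          by (rule schwartz_bruhat_mult_locally_constant)
        hence "K \<psi> ?\<phi> = u (tensor ?\<phi> \<psi>)"
          using K \<psi>(1) by (simp add: is_kernel_def)
        also have "tensor ?\<phi> \<psi> =
            (\<lambda>z. tensor \<phi> \<psi> z * \<Psi> (std_bilinear z (l *s vec_join \<xi> 0)))"
          by (simp add: tensor_def fun_eq_iff std_bilinear_vec_join_0)
        finally show ?thesis .
      qed
      thus ?thesis
        using N joinV by (intro exI[of _ N]) simp
    qed
    thus ?thesis
      unfolding microlocally_smooth_def using A X D D0
      by (intro exI[of _ "A \<inter> X"] exI[of _ D]) auto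
  qed
  thus thesis
    using C that by blast
qed

text \<open>Compactness of the support leaves finitely many sets C y, and induction on their number
  cuts \<open>\<psi>\<close> into pieces to which the local statement applies.\<close>

lemma kernel_microlocally_smooth:
  fixes X :: "('p::prime_card padic ^ 'm::finite) set" and Y :: "('p padic ^ 'n::finite) set"
  assumes \<Psi>: "additive_character \<Psi>" and X: "open X" "x \<in> X" and \<xi>: "\<xi> \<noteq> 0"
    and K: "is_kernel X Y u K" and \<psi>: "\<psi> \<in> schwartz_bruhat Y"
    and u: "\<And>y. y \<in> supp_on Y \<psi> \<Longrightarrow>
      microlocally_smooth \<Psi> \<Lambda> (vec_prod X Y) u (vec_join x y) (vec_join \<xi> 0)"
  shows "microlocally_smooth \<Psi> \<Lambda> X (K \<psi>) x \<xi>"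
proof -
  let ?S = "supp_on Y \<psi>"
  have "\<exists>C. open C \<and> closed C \<and> y \<in> C \<and> (\<forall>\<psi>\<in>schwartz_bruhat Y.
      {y. \<psi> y \<noteq> 0} \<subseteq> C \<longrightarrow> microlocally_smooth \<Psi> \<Lambda> X (K \<psi>) x \<xi>)"
    if "y \<in> ?S" for y
    using kernel_microlocally_smooth_local[OF \<Psi> X K u[OF that]] by metis
  then obtain C where C: "\<And>y. y \<in> ?S \<Longrightarrow> open (C y) \<and> closed (C y) \<and> y \<in> C y"
    and Cs: "\<And>y \<psi>. y \<in> ?S \<Longrightarrow> \<psi> \<in> schwartz_bruhat Y \<Longrightarrow> {y. \<psi> y \<noteq> 0} \<subseteq> C y \<Longrightarrow>
      microlocally_smooth \<Psi> \<Lambda> X (K \<psi>) x \<xi>"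
    by metis
  have add: "K (\<lambda>y. \<psi> y + \<psi>' y) \<phi> = K \<psi> \<phi> + K \<psi>' \<phi>"
    if "\<psi> \<in> schwartz_bruhat Y" "\<psi>' \<in> schwartz_bruhat Y" "\<phi> \<in> schwartz_bruhat X" for \<psi> \<psi>' \<phi>
    using K that by (simp add: is_kernel_def)
  have scale: "K (\<lambda>y. c * \<psi> y) \<phi> = c * K \<psi> \<phi>"
    if "\<psi> \<in> schwartz_bruhat Y" "\<phi> \<in> schwartz_bruhat X" for c \<psi> \<phi>
    using K that by (simp add: is_kernel_def)
  \<comment> \<open>Stated for general \<open>\<psi>'\<close>, since the induction hypothesis is
    applied to a cut piece; the centres in F stay in the support of the original
    \<open>\<psi>\<close>.\<close>
  have finite_cover: "microlocally_smooth \<Psi> \<Lambda> X (K \<psi>') x \<xi>"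
    if "finite F" "F \<subseteq> ?S" "\<psi>' \<in> schwartz_bruhat Y" "{y. \<psi>' y \<noteq> 0} \<subseteq> (\<Union>y\<in>F. C y)" for F \<psi>'
    using that
  proof (induction F arbitrary: \<psi>')
    case empty
    \<comment> \<open>An empty cover forces \<open>\<psi>'\<close> to vanish; homogeneity of K with
      c = 0 then kills \<open>K \<psi>'\<close>.\<close>
    hence "\<psi>' = (\<lambda>y. 0 * \<psi>' y)"
      by auto
    hence "K \<psi>' \<phi> = 0" if "\<phi> \<in> schwartz_bruhat X" for \<phi>
      using scale[of \<psi>' \<phi> 0] empty.prems that by simp
    thus ?case
      using \<Psi> X \<xi> by (intro microlocally_smooth_zero)
  next
    case (insert a F)
    \<comment> \<open>The part inside C a is smooth by the choice of C a; the part outside is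
      covered by the sets belonging to F.\<close>
    let ?\<psi>1 = "\<lambda>y. \<psi>' y * indicator (C a) y"
    let ?\<psi>2 = "\<lambda>y. \<psi>' y * indicator (- C a) y"
    have a: "a \<in> ?S" "open (C a)" "closed (C a)"
      using insert.prems C by auto
    have SB: "?\<psi>1 \<in> schwartz_bruhat Y" "?\<psi>2 \<in> schwartz_bruhat Y"
      using a insert.prems by (auto intro!: schwartz_bruhat_mult_indicator)
    have eq: "\<psi>' = (\<lambda>y. ?\<psi>1 y + ?\<psi>2 y)"
      by (auto simp: fun_eq_iff indicator_def)
    have "microlocally_smooth \<Psi> \<Lambda> X (K ?\<psi>1) x \<xi>"
      using a(1) SB(1) by (rule Cs) (auto simp: indicator_def split: if_splits)
    moreover have "microlocally_smooth \<Psi> \<Lambda> X (K ?\<psi>2) x \<xi>"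
      using SB(2) insert.prems
      by (intro insert.IH) (auto simp: indicator_def split: if_splits)
    moreover have "K \<psi>' \<phi> = K ?\<psi>1 \<phi> + K ?\<psi>2 \<phi>" if "\<phi> \<in> schwartz_bruhat X" for \<phi>
      by (subst eq) (rule add[OF SB that])
    ultimately show ?case
      using \<Psi> by (rule microlocally_smooth_add)
  qed
  have "compact ?S"
    using \<psi> by (simp add: schwartz_bruhat_def)
  then obtain F where "F \<subseteq> ?S" "finite F" "?S \<subseteq> (\<Union>y\<in>F. C y)"
    using C by (elim compactE_image[of ?S ?S C]) auto
  thus ?thesis
    using finite_cover \<psi> by (simp add: supp_on_schwartz_bruhat[OF \<psi>])
qed

theorem theorem1p18:
  fixes \<Psi> :: "'p::prime_card padic \<Rightarrow> complex"
    and \<Lambda> :: "'p padic set"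
    and X :: "('p padic ^ 'm::finite) set"
    and Y :: "('p padic ^ 'n::finite) set"
    and u :: "('p padic ^ ('m + 'n) \<Rightarrow> complex) \<Rightarrow> complex"
    and K :: "('p padic ^ 'n \<Rightarrow> complex) \<Rightarrow> ('p padic ^ 'm \<Rightarrow> complex) \<Rightarrow> complex"
    and \<psi> :: "'p padic ^ 'n \<Rightarrow> complex"
  assumes "additive_character \<Psi>"
    and "open_finite_index_subgroup \<Lambda>"
    and "open X" and "open Y"
    and "u \<in> distributions (vec_prod X Y)"
    and "is_kernel X Y u K"
    and "\<psi> \<in> schwartz_bruhat Y"
  shows "wave_front_set \<Psi> \<Lambda> X (K \<psi>) \<subseteq>
    {(x, \<xi>). x \<in> X \<and> \<xi> \<noteq> 0 \<and>
       (\<exists>y\<in>supp_on Y \<psi>. (vec_join x y, vec_join \<xi> 0) \<in> wave_front_set \<Psi> \<Lambda> (vec_prod X Y) u)}"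
proof (intro subsetI, clarify)
  fix x \<xi> assume "(x, \<xi>) \<in> wave_front_set \<Psi> \<Lambda> X (K \<psi>)"
  hence x: "x \<in> X" "\<xi> \<noteq> 0" "\<not> microlocally_smooth \<Psi> \<Lambda> X (K \<psi>) x \<xi>"
    by (auto simp: wave_front_set_def)
  \<comment> \<open>Contrapositive: smoothness of u over all y in the support would make
    \<open>K \<psi>\<close> smooth at \<open>(x, \<xi>)\<close>.\<close>
  obtain y where y: "y \<in> supp_on Y \<psi>"
    "\<not> microlocally_smooth \<Psi> \<Lambda> (vec_prod X Y) u (vec_join x y) (vec_join \<xi> 0)"
    using kernel_microlocally_smooth[OF assms(1,3) x(1,2) assms(6,7)] x(3) by blast
  \<comment> \<open>Besides failure of smoothness, the wave front set asks for a base point in the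
    product and a nonzero covector.\<close>
  have "vec_join x y \<in> vec_prod X Y"
    using x(1) y(1) by (simp add: mem_vec_prod_iff supp_on_def)
  moreover have "vec_left (0 :: 'p padic ^ ('m + 'n)) = 0"
    by (simp add: vec_left_def vec_eq_iff)
  hence "vec_join \<xi> (0 :: 'p padic ^ 'n) \<noteq> 0"
    using x(2) by (metis vec_left_join)
  ultimately have "(vec_join x y, vec_join \<xi> 0) \<in> wave_front_set \<Psi> \<Lambda> (vec_prod X Y) u"
    using y(2) by (simp add: wave_front_set_def)
  with x y(1) show "x \<in> X \<and> \<xi> \<noteq> 0 \<and>
      (\<exists>y\<in>supp_on Y \<psi>. (vec_join x y, vec_join \<xi> 0) \<in> wave_front_set \<Psi> \<Lambda> (vec_prod X Y) u)"
    by blast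
qed

end
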